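(* Let $I\subset\mathbb{R}$ be an interval and let $p\in\mathbb{N}$ with $p>1$. Assume that $\mathbf{M}\colon I^p\to I^p$ is a mean-type mapping and that $K\colon I^p\to I$ is the unique $\mathbf{M}$-invariant mean. Let $F\colon I^p\to\mathbb{R}$ be a function which is continuous at every point of the diagonal $\Delta(I^p):=\{(u_1,\dots,u_p)\in I^p: u_1=\dots=u_p\}$. Then $F$ satisfies the functional equation $F\circ\mathbf{M}=F$ if and only if there is a continuous function $\varphi\colon I\to\mathbb{R}$ such that $F=\varphi\circ K$.
   Context: A function $M\colon I^p\to I$ is called a mean (in $I$) if $\min(v_1,\dots,v_p)\le M(v_1,\dots,v_p)\le \max(v_1,\dots,v_p)$ for all $v_1,\dots,v_p\in I$; means are not assumed continuous. A mapping $\mathbf{M}\colon I^p\to I^p$ is called mean-type if $\mathbf{M}=(M_1,\dots,M_p)$ for some means $M_1,\dots,M_p\colon I^p\to I$. A function $K\colon I^p\to\mathbb{R}$ is $\mathbf{M}$-invariant if $K\circ\mathbf{M}=K$. *)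

theory Defs
  imports "HOL-Analysis.Analysis"
begin

definition cube :: "real set \<Rightarrow> (real ^ 'p) set" where
  "cube I = {v. \<forall>i. v $ i \<in> I}"

definition diagonal :: "real set \<Rightarrow> (real ^ 'p) set" where
  "diagonal I = {v \<in> cube I. \<forall>i j. v $ i = v $ j}"

(* Functions on cube I are total functions on real ^ 'p of which only the values on
   cube I matter; no condition is imposed elsewhere. *)

definition mean_on :: "real set \<Rightarrow> (real ^ 'p \<Rightarrow> real) \<Rightarrow> bool" where
  "mean_on I M \<longleftrightarrow> M \<in> cube I \<rightarrow> I \<and>
     (\<forall>v\<in>cube I. Min (range (($) v)) \<le> M v \<and> M v \<le> Max (range (($) v)))"

definition mean_type_on :: "real set \<Rightarrow> (real ^ 'p \<Rightarrow> real ^ 'p) \<Rightarrow> bool" where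
  "mean_type_on I M \<longleftrightarrow> (\<forall>i. mean_on I (\<lambda>v. M v $ i))"

definition invariant_on :: "real set \<Rightarrow> (real ^ 'p \<Rightarrow> real ^ 'p) \<Rightarrow> (real ^ 'p \<Rightarrow> real) \<Rightarrow> bool" where
  "invariant_on I M K \<longleftrightarrow> (\<forall>v\<in>cube I. (K \<circ> M) v = K v)"

(* Uniqueness is uniqueness of the restriction to cube I. *)
definition unique_invariant_mean :: "real set \<Rightarrow> (real ^ 'p \<Rightarrow> real ^ 'p) \<Rightarrow> (real ^ 'p \<Rightarrow> real) \<Rightarrow> bool" where
  "unique_invariant_mean I M K \<longleftrightarrow> mean_on I K \<and> invariant_on I M K \<and>
     (\<forall>L. mean_on I L \<and> invariant_on I M L \<longrightarrow> (\<forall>v\<in>cube I. L v = K v))"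

end

theory Submission imports Defs begin

text \<open>
  Along an orbit of a mean-type mapping the least coordinate increases and the greatest
  decreases, so both converge.  As functions of the starting point their limits are invariant
  means (lemma \<open>orbit_limit_invariant_mean\<close>), and uniqueness of the invariant
  mean forces both to be \<open>K\<close>.  Hence every orbit starting at \<open>v\<close> is squeezed onto the diagonal point whose coordinates all equal \<open>K v\<close>
  (lemma \<open>orbit_tendsto_diagonal\<close>).  A solution \<open>F\<close> of the functional equation is constant along
  orbits, so continuity at that single point gives \<open>F v = F (K v, \<dots>, K v)\<close>.  Thus \<open>\<phi>\<close> has to be
  the restriction of \<open>F\<close> to the diagonal, and it is continuous because \<open>F\<close> is continuous there.
  The converse is immediate from the invariance of \<open>K\<close>.
\<close>

abbreviation vmin :: "real ^ 'p \<Rightarrow> real" where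
  "vmin v \<equiv> Min (range (($) v))"

abbreviation vmax :: "real ^ 'p \<Rightarrow> real" where
  "vmax v \<equiv> Max (range (($) v))"

lemma vmin_le: "vmin v \<le> v $ i"
  by (rule Min_le) auto

lemma le_vmax: "v $ i \<le> vmax v"
  by (rule Max_ge) auto

lemma vmin_in:
  assumes "v \<in> cube I"
  shows "vmin v \<in> I"
proof -
  have "vmin v \<in> range (($) v)"
    by (rule Min_in) auto
  then obtain i where "vmin v = v $ i"
    by (rule rangeE)
  then show ?thesis
    using assms by (simp add: cube_def)
qed

lemma vmax_in:
  assumes "v \<in> cube I"
  shows "vmax v \<in> I"
proof -
  have "vmax v \<in> range (($) v)"
    by (rule Max_in) auto
  then obtain i where "vmax v = v $ i"
    by (rule rangeE)
  then show ?thesis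
    using assms by (simp add: cube_def)
qed

lemma mean_type_cube:
  assumes "mean_type_on I M" "v \<in> cube I"
  shows "M v \<in> cube I"
  using assms by (auto simp: mean_type_on_def mean_on_def cube_def Pi_iff)

lemma mean_type_vmin_mono:
  assumes "mean_type_on I M" "v \<in> cube I"
  shows "vmin v \<le> vmin (M v)"
  using assms by (auto simp: mean_type_on_def mean_on_def)

lemma mean_type_vmax_antimono:
  assumes "mean_type_on I M" "v \<in> cube I"
  shows "vmax (M v) \<le> vmax v"
  using assms by (auto simp: mean_type_on_def mean_on_def)

lemma orbit_in_cube:
  assumes "mean_type_on I M" "v \<in> cube I"
  shows "(M ^^ n) v \<in> cube I"
  using assms(2) by (induction n) (simp_all add: mean_type_cube[OF assms(1)])

lemma orbit_incseq_vmin: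
  assumes "mean_type_on I M" "v \<in> cube I"
  shows "incseq (\<lambda>n. vmin ((M ^^ n) v))"
  using mean_type_vmin_mono[OF assms(1) orbit_in_cube[OF assms]]
  by (intro incseq_SucI) simp

lemma orbit_decseq_vmax:
  assumes "mean_type_on I M" "v \<in> cube I"
  shows "decseq (\<lambda>n. vmax ((M ^^ n) v))"
  using mean_type_vmax_antimono[OF assms(1) orbit_in_cube[OF assms]]
  by (intro decseq_SucI) simp

lemma orbit_bounds:
  assumes "mean_type_on I M" "v \<in> cube I"
  shows "vmin v \<le> vmin ((M ^^ n) v)" "vmax ((M ^^ n) v) \<le> vmax v"
  using incseqD[OF orbit_incseq_vmin[OF assms], of 0 n]
        decseqD[OF orbit_decseq_vmax[OF assms], of 0 n] by simp_all

lemma vmin_le_vmax: "vmin v \<le> vmax v"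
  using order_trans[OF vmin_le le_vmax] .

lemma convergent_vmin_orbit:
  assumes "mean_type_on I M" "v \<in> cube I"
  shows "convergent (\<lambda>n. vmin ((M ^^ n) v))"
proof -
  have "vmin ((M ^^ n) v) \<le> vmax v" for n
    using vmin_le_vmax orbit_bounds(2)[OF assms] by (rule order_trans)
  then show ?thesis
    using incseq_convergent[OF orbit_incseq_vmin[OF assms]] by (metis convergent_def)
qed

lemma convergent_vmax_orbit:
  assumes "mean_type_on I M" "v \<in> cube I"
  shows "convergent (\<lambda>n. vmax ((M ^^ n) v))"
proof -
  have "vmin v \<le> vmax ((M ^^ n) v)" for n
    using orbit_bounds(1)[OF assms] vmin_le_vmax by (rule order_trans)
  then show ?thesis
    using decseq_convergent[OF orbit_decseq_vmax[OF assms]] by (metis convergent_def)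
qed

text \<open>
  The coordinates along an orbit stay in the range spanned by those of its starting point, which
  makes the limit a mean, and replacing \<open>v\<close> by \<open>M v\<close> only drops the first term of the sequence,
  which makes it invariant.  The cases of interest are the least and the greatest coordinate
  as \<open>g\<close>; taking \<open>g\<close> as a parameter treats both at once.
\<close>

lemma orbit_limit_invariant_mean:
  fixes g :: "real ^ 'p \<Rightarrow> real"
  assumes I: "is_interval I" and M: "mean_type_on I M"
    and g: "\<And>v. vmin v \<le> g v" "\<And>v. g v \<le> vmax v"
    and conv: "\<And>v. v \<in> cube I \<Longrightarrow> convergent (\<lambda>n. g ((M ^^ n) v))"
  defines "L \<equiv> \<lambda>v. lim (\<lambda>n. g ((M ^^ n) v))"
  shows "mean_on I L" "invariant_on I M L"
proof -
  have lim: "(\<lambda>n. g ((M ^^ n) v)) \<longlonglongrightarrow> L v" if "v \<in> cube I" for v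
    using conv[OF that] by (simp add: L_def convergent_LIMSEQ_iff)
  have bounds: "vmin v \<le> L v" "L v \<le> vmax v" if v: "v \<in> cube I" for v
  proof -
    have "vmin v \<le> g ((M ^^ n) v)" "g ((M ^^ n) v) \<le> vmax v" for n
      using orbit_bounds[OF M v, of n] g[of "(M ^^ n) v"] by linarith+
    then show "vmin v \<le> L v" "L v \<le> vmax v"
      using LIMSEQ_le_const[OF lim[OF v]] LIMSEQ_le_const2[OF lim[OF v]] by blast+
  qed
  have "L v \<in> I" if v: "v \<in> cube I" for v
    using I bounds[OF v] vmin_in[OF v] vmax_in[OF v] unfolding is_interval_1 by blast
  then show "mean_on I L"
    using bounds by (auto simp: mean_on_def)
  have "L (M v) = L v" if v: "v \<in> cube I" for v
  proof -
    have "(\<lambda>n. g ((M ^^ n) (M v))) \<longlonglongrightarrow> L v"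
      using LIMSEQ_Suc[OF lim[OF v]] by (simp only: funpow_Suc_right comp_apply)
    then show ?thesis
      using lim[OF mean_type_cube[OF M v]] LIMSEQ_unique by blast
  qed
  then show "invariant_on I M L"
    by (simp add: invariant_on_def)
qed

text \<open>
  Uniqueness of the invariant mean enters here: it identifies the limit of the least
  coordinate with that of the greatest, and the remaining coordinates lie in between.
\<close>

lemma orbit_tendsto_diagonal:
  fixes M :: "real ^ 'p \<Rightarrow> real ^ 'p"
  assumes I: "is_interval I" and M: "mean_type_on I M"
    and K: "unique_invariant_mean I M K" and v: "v \<in> cube I"
  shows "(\<lambda>n. (M ^^ n) v) \<longlonglongrightarrow> vec (K v)"
proof -
  have limK: "(\<lambda>n. g ((M ^^ n) v)) \<longlonglongrightarrow> K v"
    if "\<And>v. vmin v \<le> g v" "\<And>v. g v \<le> vmax v"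
      and conv: "\<And>v. v \<in> cube I \<Longrightarrow> convergent (\<lambda>n. g ((M ^^ n) v))" for g
  proof -
    have "lim (\<lambda>n. g ((M ^^ n) v)) = K v"
      using orbit_limit_invariant_mean[OF I M that] K v
      by (simp add: unique_invariant_mean_def)
    then show ?thesis
      using conv[OF v] by (simp add: convergent_LIMSEQ_iff)
  qed
  have lo: "(\<lambda>n. vmin ((M ^^ n) v)) \<longlonglongrightarrow> K v"
    by (rule limK[OF order_refl vmin_le_vmax convergent_vmin_orbit[OF M]])
  have hi: "(\<lambda>n. vmax ((M ^^ n) v)) \<longlonglongrightarrow> K v"
    by (rule limK[OF vmin_le_vmax order_refl convergent_vmax_orbit[OF M]])
  have "(\<lambda>n. (M ^^ n) v $ i) \<longlonglongrightarrow> K v" for i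
    by (rule real_tendsto_sandwich[OF _ _ lo hi]) (intro always_eventually allI vmin_le le_vmax)+
  then show ?thesis
    by (intro vec_tendstoI) simp
qed

lemma vec_in_diagonal: "x \<in> I \<Longrightarrow> vec x \<in> diagonal I"
  by (simp add: diagonal_def cube_def)

lemma diagonal_subset_cube: "diagonal I \<subseteq> cube I"
  by (auto simp: diagonal_def)

lemma continuous_on_diagonal_restriction:
  fixes F :: "real ^ 'p \<Rightarrow> real"
  assumes "\<forall>u\<in>diagonal I. continuous (at u within cube I) F"
  shows "continuous_on I (\<lambda>x. F (vec x))"
proof (rule continuous_on_compose2[of "diagonal I" F])
  show "continuous_on (diagonal I) F"
    using assms diagonal_subset_cube
    by (auto simp: continuous_on_eq_continuous_within intro: continuous_within_subset)
  have "continuous_on I (\<lambda>x. \<chi> i::'p. x)"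
    by (intro continuous_on_vec_lambda continuous_on_id)
  then show "continuous_on I (vec :: real \<Rightarrow> real ^ 'p)"
    by (simp add: vec_def)
qed (auto intro: vec_in_diagonal)

lemma invariant_constant_on_orbit:
  assumes M: "mean_type_on I M" and F: "\<forall>v\<in>cube I. (F \<circ> M) v = F v" and v: "v \<in> cube I"
  shows "F ((M ^^ n) v) = F v"
  using F orbit_in_cube[OF M v] by (induction n) auto

theorem theorem3:
  fixes I :: "real set"
    and M :: "real ^ 'p \<Rightarrow> real ^ 'p"
    and K F :: "real ^ 'p \<Rightarrow> real"
  assumes "is_interval I"
    and "CARD('p) > 1"
    and "mean_type_on I M"
    and "unique_invariant_mean I M K"
    and "\<forall>u\<in>diagonal I. continuous (at u within cube I) F"
  shows "(\<forall>v\<in>cube I. (F \<circ> M) v = F v) \<longleftrightarrow>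
         (\<exists>\<phi> :: real \<Rightarrow> real. continuous_on I \<phi> \<and> (\<forall>v\<in>cube I. F v = (\<phi> \<circ> K) v))"
proof
  assume F: "\<forall>v\<in>cube I. (F \<circ> M) v = F v"
  have "F v = F (vec (K v))" if v: "v \<in> cube I" for v
  proof -
    have "K v \<in> I"
      using assms(4) v by (auto simp: unique_invariant_mean_def mean_on_def)
    then have "continuous (at (vec (K v)) within cube I) F"
      using assms(5) vec_in_diagonal by blast
    then have "(\<lambda>n. F ((M ^^ n) v)) \<longlonglongrightarrow> F (vec (K v))"
      using orbit_in_cube[OF assms(3) v] orbit_tendsto_diagonal[OF assms(1,3,4) v]
      by (auto simp: continuous_within_sequentially o_def)
    then show ?thesis
      by (simp add: invariant_constant_on_orbit[OF assms(3) F v] LIMSEQ_const_iff)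
  qed
  then show "\<exists>\<phi>. continuous_on I \<phi> \<and> (\<forall>v\<in>cube I. F v = (\<phi> \<circ> K) v)"
    using continuous_on_diagonal_restriction[OF assms(5)]
    by (intro exI[of _ "\<lambda>x. F (vec x)"]) simp
next
  assume "\<exists>\<phi>. continuous_on I \<phi> \<and> (\<forall>v\<in>cube I. F v = (\<phi> \<circ> K) v)"
  then obtain \<phi> where \<phi>: "F v = \<phi> (K v)" if "v \<in> cube I" for v
    by auto
  show "\<forall>v\<in>cube I. (F \<circ> M) v = F v"
  proof
    fix v :: "real ^ 'p"
    assume v: "v \<in> cube I"
    have "K (M v) = K v"
      using assms(4) v by (simp add: unique_invariant_mean_def invariant_on_def)
    then show "(F \<circ> M) v = F v"
      using \<phi>[OF v] \<phi>[OF mean_type_cube[OF assms(3) v]] by simp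
  qed
qed

end
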